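(* Let $S,T>0$ and $R=[0,S]\times[0,T]$. Suppose $\lambda:[0,S+T]\to\mathbb{R}$ satisfies: (1) $\lambda(0)=0$; (2) $\lambda$ is continuously differentiable on $(0,S+T)$, with one-sided derivatives at the endpoints, and $\lambda'(u)>0$ for all $u\in[0,S+T]$. For $s+t>0$ define $$K_1(s,t,\sigma)=\frac{\lambda'(\sigma+t)}{2\lambda(s+t)},\qquad K_2(s,t,\tau)=\frac{\lambda'(s+\tau)}{2\lambda(s+t)}.$$ Then for any $f\in C_0(R)$ the Volterra equation $$x(s,t)=f(s,t)+\int_0^s K_1(s,t,\sigma)\,x(\sigma,t)\,d\sigma+\int_0^t K_2(s,t,\tau)\,x(s,\tau)\,d\tau$$ admits a unique solution $x\in C_0(R)$.
   Context: $C_0(R)$ denotes the Banach space (supremum norm) of continuous real functions on $R$ that vanish on the axes, i.e. $x(s,0)=0$ for $0\le s\le S$ and $x(0,t)=0$ for $0\le t\le T$. The kernels are only defined for $s+t>0$; at the origin $(0,0)$ the sum of the integral terms is taken to be $0$, so the equation there reads $x(0,0)=f(0,0)=0$, and it is a genuine condition for $(s,t)\in R\setminus\{(0,0)\}$. The values of $\lambda'$ at $0$ and $S+T$ are the one-sided derivatives. *)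

theory Defs
  imports "HOL-Analysis.Analysis"
begin

definition rect :: "real \<Rightarrow> real \<Rightarrow> (real \<times> real) set" where
  "rect S T = {0..S} \<times> {0..T}"

text \<open>Functions on the rectangle are represented by extensional functions, so that equality in
  this set is equality on the rectangle.\<close>

definition C0 :: "real \<Rightarrow> real \<Rightarrow> (real \<times> real \<Rightarrow> real) set" where
  "C0 S T = {x \<in> extensional (rect S T). continuous_on (rect S T) x \<and>
     (\<forall>s\<in>{0..S}. x (s, 0) = 0) \<and> (\<forall>t\<in>{0..T}. x (0, t) = 0)}"

definition K1 :: "(real \<Rightarrow> real) \<Rightarrow> (real \<Rightarrow> real) \<Rightarrow> real \<Rightarrow> real \<Rightarrow> real \<Rightarrow> real" where
  "K1 lam lam' s t \<sigma> = lam' (\<sigma> + t) / (2 * lam (s + t))"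

definition K2 :: "(real \<Rightarrow> real) \<Rightarrow> (real \<Rightarrow> real) \<Rightarrow> real \<Rightarrow> real \<Rightarrow> real \<Rightarrow> real" where
  "K2 lam lam' s t \<tau> = lam' (s + \<tau>) / (2 * lam (s + t))"

text \<open>The equation at a point, including the existence of both integrals (the library integral of a
  non-integrable function is \<open>0\<close>). The kernels are undefined at the origin, where the integral
  terms are taken to be \<open>0\<close>.\<close>

definition volterra_at ::
  "(real \<Rightarrow> real) \<Rightarrow> (real \<Rightarrow> real) \<Rightarrow> (real \<times> real \<Rightarrow> real) \<Rightarrow> (real \<times> real \<Rightarrow> real) \<Rightarrow>
    real \<Rightarrow> real \<Rightarrow> bool" where
  "volterra_at lam lam' f x s t \<longleftrightarrow>
     (if s = 0 \<and> t = 0 then x (s, t) = f (s, t)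
      else (\<lambda>\<sigma>. K1 lam lam' s t \<sigma> * x (\<sigma>, t)) integrable_on {0..s} \<and>
           (\<lambda>\<tau>. K2 lam lam' s t \<tau> * x (s, \<tau>)) integrable_on {0..t} \<and>
           x (s, t) = f (s, t)
             + integral {0..s} (\<lambda>\<sigma>. K1 lam lam' s t \<sigma> * x (\<sigma>, t))
             + integral {0..t} (\<lambda>\<tau>. K2 lam lam' s t \<tau> * x (s, \<tau>)))"

end

theory Submission
  imports Defs
begin

text \<open>
The right-hand side of the equation is a contraction in the supremum norm, so Banach's fixed point
theorem gives existence and uniqueness at once. Both kernels are positive, and since \<open>lam\<close> is an
antiderivative of \<open>lam'\<close>, their total mass at \<open>(s, t)\<close> is
\<open>1 - (lam s + lam t) / (2 * lam (s + t))\<close>.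
This stays away from \<open>1\<close>: as \<open>lam u / u\<close> extends by \<open>lam' 0\<close> to a continuous positive function on
the compact interval \<open>[0, S + T]\<close>, there are constants \<open>0 < c \<le> C\<close> with \<open>c u \<le> lam u \<le> C u\<close>
(\<open>lam_linear_bounds\<close>), and hence the mass is at most \<open>1 - c / (2 C)\<close>
(\<open>volterra_op_contraction\<close>).

The remaining point is that the integral operator maps continuous functions vanishing on the axes
to such functions, although \<open>lam'\<close> may be unbounded and discontinuous at the ends of its interval. The
substitution \<open>\<theta> = (lam (\<sigma> + t) - lam t) / (lam (s + t) - lam t)\<close> removes \<open>lam'\<close> altogether
(\<open>weighted_integral\<close>): each integral becomes an increment of \<open>lam\<close> times an average of \<open>x\<close> over
\<open>[0, 1]\<close> whose integrand is jointly continuous in \<open>(s, t, \<theta>)\<close>. Continuity off the origin is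
then that of an integral with parameters. At the origin the quotients
\<open>(lam (s + t) - lam t) / (2 lam (s + t))\<close> have no limit but are bounded, while the averages tend to
\<open>x (0, 0) = 0\<close> (\<open>volterra_op_vanishing\<close>).
\<close>

section \<open>Contractions on continuous functions over a box\<close>

text \<open>
Banach's theorem for functions on a box that vanish on a prescribed set \<open>N\<close>. The complete metric
space is a closed subset of the bounded continuous functions on the whole space: a function on the
box is extended by composing it with the projection \<open>clamp\<close> onto the box, which preserves the
supremum norm. The contraction hypothesis with \<open>M = 0\<close> says that \<open>P x\<close> on the box depends only on
\<open>x\<close> on the box, so fixed points may be moved between the extended and the extensional
representation.
\<close>

lemma contraction_on_box_unique_fixed_point:
  fixes P :: "('a::euclidean_space \<Rightarrow> real) \<Rightarrow> 'a \<Rightarrow> real" and N :: "'a set"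
  assumes ne: "cbox a b \<noteq> {}" and N: "N \<subseteq> cbox a b" and q: "0 \<le> q" "q < 1"
    and D: "D = {x. continuous_on (cbox a b) x \<and> (\<forall>p\<in>N. x p = 0)}"
    and maps: "\<And>x. x \<in> D \<Longrightarrow> P x \<in> D"
    and contr: "\<And>x y M p. \<lbrakk>x \<in> D; y \<in> D; \<And>r. r \<in> cbox a b \<Longrightarrow> \<bar>x r - y r\<bar> \<le> M; p \<in> cbox a b\<rbrakk>
      \<Longrightarrow> \<bar>P x p - P y p\<bar> \<le> q * M"
  shows "\<exists>!x. x \<in> extensional (cbox a b) \<and> x \<in> D \<and> (\<forall>p\<in>cbox a b. x p = P x p)"
proof -
  have "\<forall>x. \<exists>g::'a \<Rightarrow>\<^sub>C real. continuous_on (cbox a b) x \<longrightarrow> (\<forall>p. g p = x (clamp a b p))"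
    by (metis continuous_on_cbox_bcontfunE)
  then obtain E :: "('a \<Rightarrow> real) \<Rightarrow> 'a \<Rightarrow>\<^sub>C real"
    where "\<And>x. continuous_on (cbox a b) x \<Longrightarrow> (\<forall>p. E x p = x (clamp a b p))"
    by metis
  then have E: "E x p = x (clamp a b p)" if "x \<in> D" for x p
    using that D by auto
  have clamp: "clamp a b p \<in> cbox a b" for p
    using ne by (simp add: box_ne_empty)
  have E_on: "E x p = x p" if "x \<in> D" "p \<in> cbox a b" for x p
    using E that by simp
  have D_cong: "y \<in> D" if "x \<in> D" "\<And>p. p \<in> cbox a b \<Longrightarrow> x p = y p" for x y
    using that N unfolding D by (auto simp: subset_iff cong: continuous_on_cong)
  have P_cong: "P x p = P y p"
    if "x \<in> D" "\<And>p. p \<in> cbox a b \<Longrightarrow> x p = y p" "p \<in> cbox a b" for x y p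
    using contr[OF that(1) D_cong[OF that(1,2)], of 0 p] that by simp
  define Z where "Z = {F :: 'a \<Rightarrow>\<^sub>C real. apply_bcontfun F \<in> D}"
  define \<Psi> where "\<Psi> F = E (P (apply_bcontfun F))" for F
  have "Z = PiC N (\<lambda>_. {0})"
    by (auto simp: Z_def D mem_PiC_iff)
  then have Z: "complete Z"
    by (simp add: closed_PiC complete_eq_closed)
  have "E (\<lambda>_. 0) \<in> Z"
    using D_cong[of "\<lambda>_. 0" "apply_bcontfun (E (\<lambda>_. 0))"] E_on[of "\<lambda>_. 0"] by (simp add: Z_def D)
  then have Z_ne: "Z \<noteq> {}" by auto
  have E_Z: "E x \<in> Z" if "x \<in> D" for x
    using D_cong[of x "apply_bcontfun (E x)"] E_on that by (simp add: Z_def)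
  have "dist (\<Psi> F) (\<Psi> G) \<le> q * dist F G" if "F \<in> Z" "G \<in> Z" for F G
  proof (rule dist_bound)
    fix p
    have "\<bar>P F (clamp a b p) - P G (clamp a b p)\<bar> \<le> q * dist F G"
      using that dist_bounded[of F _ G] by (intro contr clamp) (auto simp: Z_def dist_real_def)
    then show "dist (\<Psi> F p) (\<Psi> G p) \<le> q * dist F G"
      using that maps by (simp add: \<Psi>_def E Z_def dist_real_def)
  qed
  then have fix1: "\<exists>!F\<in>Z. \<Psi> F = F"
    using E_Z maps by (intro Banach_fix[OF Z Z_ne q]) (auto simp: \<Psi>_def Z_def)
  then obtain F where F: "F \<in> Z" "\<Psi> F = F" by blast
  show ?thesis
  proof (rule ex_ex1I)
    let ?x = "restrict (apply_bcontfun F) (cbox a b)"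
    have FD: "apply_bcontfun F \<in> D" using F by (simp add: Z_def)
    then have "?x \<in> D" by (rule D_cong) simp
    moreover have "?x p = P ?x p" if "p \<in> cbox a b" for p
    proof -
      have "?x p = \<Psi> F p" using F that by simp
      also have "\<dots> = P F p" using E_on maps FD that by (simp add: \<Psi>_def)
      also have "\<dots> = P ?x p" by (rule P_cong[OF FD _ that]) simp
      finally show ?thesis .
    qed
    ultimately show "\<exists>x. x \<in> extensional (cbox a b) \<and> x \<in> D \<and> (\<forall>p\<in>cbox a b. x p = P x p)"
      by blast
  next
    have fixed: "E x = \<Psi> (E x)" if "x \<in> D" "\<forall>p\<in>cbox a b. x p = P x p" for x
    proof (rule bcontfun_eqI)
      fix p
      have "\<Psi> (E x) p = P (E x) (clamp a b p)"
        using E_Z that maps by (simp add: \<Psi>_def E Z_def)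
      also have "\<dots> = P x (clamp a b p)"
        using P_cong[of x "apply_bcontfun (E x)"] that clamp E_on by simp
      finally show "E x p = \<Psi> (E x) p" using that clamp E by metis
    qed
    fix x y
    assume x: "x \<in> extensional (cbox a b) \<and> x \<in> D \<and> (\<forall>p\<in>cbox a b. x p = P x p)"
      and y: "y \<in> extensional (cbox a b) \<and> y \<in> D \<and> (\<forall>p\<in>cbox a b. y p = P y p)"
    then have "E x = E y" using fix1 fixed E_Z by metis
    then have "x p = y p" if "p \<in> cbox a b" for p using E_on x y that by metis
    then show "x = y" using x y by (intro extensionalityI[of x "cbox a b"]) auto
  qed
qed

section \<open>Averages along a monotone change of variable\<close>

locale monotone_weight =
  fixes L :: real and lam lam' :: "real \<Rightarrow> real"
  assumes L_pos: "L > 0"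
    and lam_0: "lam 0 = 0"
    and deriv: "\<And>u. u \<in> {0..L} \<Longrightarrow> (lam has_real_derivative lam' u) (at u within {0..L})"
    and lam'_pos: "\<And>u. u \<in> {0..L} \<Longrightarrow> lam' u > 0"
begin

lemma continuous_lam: "continuous_on {0..L} lam"
  using deriv by (rule DERIV_continuous_on)

lemma lam_less:
  assumes "0 \<le> u" "u < v" "v \<le> L"
  shows "lam u < lam v"
proof (rule DERIV_pos_imp_increasing_open[OF \<open>u < v\<close>])
  fix w assume "u < w" "w < v"
  then have "(lam has_real_derivative lam' w) (at w)" "lam' w > 0"
    using deriv[of w] lam'_pos[of w] assms by (auto simp: at_within_Icc_at)
  then show "\<exists>y. DERIV lam w :> y \<and> y > 0" by blast
next
  show "continuous_on {u..v} lam"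
    using continuous_lam by (rule continuous_on_subset) (use assms in auto)
qed

lemma lam_le: "0 \<le> u \<Longrightarrow> u \<le> v \<Longrightarrow> v \<le> L \<Longrightarrow> lam u \<le> lam v"
  using lam_less[of u v] by (cases "u = v") auto

lemma lam_pos: "0 < u \<Longrightarrow> u \<le> L \<Longrightarrow> 0 < lam u"
  using lam_less[of 0 u] lam_0 by simp

lemma inj_lam: "inj_on lam {0..L}"
  by (rule linorder_inj_onI') (use lam_less in force)

definition inv_lam :: "real \<Rightarrow> real" where
  "inv_lam = the_inv_into {0..L} lam"

lemma inv_lam_lam: "u \<in> {0..L} \<Longrightarrow> inv_lam (lam u) = u"
  unfolding inv_lam_def using inj_lam by (rule the_inv_into_f_f)

lemma continuous_inv_lam: "continuous_on (lam ` {0..L}) inv_lam"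
  unfolding inv_lam_def by (intro continuous_on_inv_into continuous_lam inj_lam compact_Icc)

lemma between_lam_obtains:
  assumes "0 \<le> u" "u \<le> v" "v \<le> L" "\<theta> \<in> {0..1}"
  obtains w where "w \<in> {u..v}" "lam w = lam u + \<theta> * (lam v - lam u)"
proof -
  have le: "lam u \<le> lam v" using lam_le assms by auto
  have "\<theta> * (lam v - lam u) \<le> 1 * (lam v - lam u)"
    using le assms by (intro mult_right_mono) auto
  then have "lam u \<le> lam u + \<theta> * (lam v - lam u)" "lam u + \<theta> * (lam v - lam u) \<le> lam v"
    using le assms by auto
  moreover have "continuous_on {u..v} lam"
    using continuous_lam by (rule continuous_on_subset) (use assms in auto)
  ultimately show ?thesis
    using IVT'[of lam u _ v] assms that by (metis atLeastAtMost_iff)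
qed

text \<open>
The point \<open>\<sigma> \<in> [0, s]\<close> at which \<open>lam (\<sigma> + t)\<close> has covered the fraction \<open>\<theta>\<close> of its way from
\<open>lam t\<close> to \<open>lam (s + t)\<close>.
\<close>

definition node :: "real \<Rightarrow> real \<Rightarrow> real \<Rightarrow> real" where
  "node s t \<theta> = inv_lam (lam t + \<theta> * (lam (s + t) - lam t)) - t"

definition avg :: "(real \<times> real \<Rightarrow> real) \<Rightarrow> real \<Rightarrow> real \<Rightarrow> real" where
  "avg x s t = integral {0..1} (\<lambda>\<theta>. x (node s t \<theta>, t))"

lemma node_in:
  assumes "0 \<le> s" "0 \<le> t" "s + t \<le> L" "\<theta> \<in> {0..1}"
  shows "node s t \<theta> \<in> {0..s}"
proof -
  obtain w where "w \<in> {t..s + t}" "lam w = lam t + \<theta> * (lam (s + t) - lam t)"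
    using between_lam_obtains[of t "s + t" \<theta>] assms by auto
  then show ?thesis
    unfolding node_def using inv_lam_lam[of w] assms by auto
qed

lemma continuous_node:
  assumes "S + T \<le> L"
  shows "continuous_on (rect S T \<times> {0..1}) (\<lambda>((s, t), \<theta>). node s t \<theta>)"
  unfolding node_def case_prod_unfold
proof (intro continuous_intros continuous_on_compose2[OF continuous_inv_lam]
    continuous_on_compose2[OF continuous_lam])
  show "(\<lambda>p. lam (snd (fst p)) + snd p * (lam (fst (fst p) + snd (fst p)) - lam (snd (fst p))))
    ` (rect S T \<times> {0..1}) \<subseteq> lam ` {0..L}"
  proof clarify
    fix s t \<theta> :: real
    assume "(s, t) \<in> rect S T" and \<theta>: "\<theta> \<in> {0..1}"
    then have st: "0 \<le> s" "0 \<le> t" "s + t \<le> L" using assms by (auto simp: rect_def)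
    obtain w where w: "w \<in> {t..s + t}" "lam w = lam t + \<theta> * (lam (s + t) - lam t)"
      using between_lam_obtains[of t "s + t" \<theta>] st \<theta> by auto
    then have "w \<in> {0..L}" using st by auto
    then show "lam (snd (fst ((s, t), \<theta>))) + snd ((s, t), \<theta>) *
        (lam (fst (fst ((s, t), \<theta>)) + snd (fst ((s, t), \<theta>))) - lam (snd (fst ((s, t), \<theta>))))
        \<in> lam ` {0..L}"
      using w by (metis fst_conv snd_conv imageI)
  qed
qed (use assms in \<open>auto simp: rect_def\<close>)

lemma continuous_avg_integrand:
  assumes x: "continuous_on (rect S T) x" and L: "S + T \<le> L"
  shows "continuous_on (rect S T \<times> {0..1}) (\<lambda>(p, \<theta>). x (node (fst p) (snd p) \<theta>, snd p))"
  unfolding case_prod_unfold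
proof (rule continuous_on_compose2[OF x])
  show "continuous_on (rect S T \<times> {0..1})
      (\<lambda>z. (node (fst (fst z)) (snd (fst z)) (snd z), snd (fst z)))"
    using continuous_node[OF L] by (auto simp: case_prod_unfold intro!: continuous_intros)
  show "(\<lambda>z. (node (fst (fst z)) (snd (fst z)) (snd z), snd (fst z))) ` (rect S T \<times> {0..1})
      \<subseteq> rect S T"
  proof clarify
    fix s t \<theta> :: real
    assume "(s, t) \<in> rect S T" "\<theta> \<in> {0..1}"
    then show "(node (fst (fst ((s, t), \<theta>))) (snd (fst ((s, t), \<theta>))) (snd ((s, t), \<theta>)),
        snd (fst ((s, t), \<theta>))) \<in> rect S T"
      using node_in[of s t \<theta>] L by (auto simp: rect_def)
  qed
qed

lemma continuous_avg:
  assumes "continuous_on (rect S T) x" "S + T \<le> L"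
  shows "continuous_on (rect S T) (\<lambda>(s, t). avg x s t)"
proof -
  have "continuous_on (rect S T)
      (\<lambda>p. integral (cbox 0 1) (\<lambda>\<theta>. x (node (fst p) (snd p) \<theta>, snd p)))"
    using continuous_avg_integrand[OF assms] by (intro integral_continuous_on_param) simp
  then show ?thesis by (simp add: avg_def case_prod_unfold)
qed

lemma avg_integrable:
  fixes x :: "real \<times> real \<Rightarrow> real"
  assumes x: "continuous_on (rect S T) x" and L: "S + T \<le> L" and st: "(s, t) \<in> rect S T"
  shows "(\<lambda>\<theta>. x (node s t \<theta>, t)) integrable_on {0..1}"
proof (rule integrable_continuous_interval)
  have "continuous_on {0..1} (\<lambda>\<theta>. (\<lambda>(p, \<theta>). x (node (fst p) (snd p) \<theta>, snd p)) ((s, t), \<theta>))"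
    using st by (intro continuous_on_compose2[OF continuous_avg_integrand[OF x L]] continuous_intros)
      auto
  then show "continuous_on {0..1} (\<lambda>\<theta>. x (node s t \<theta>, t))" by simp
qed

lemma avg_diff_le:
  assumes x: "continuous_on (rect S T) x" and y: "continuous_on (rect S T) y"
    and L: "S + T \<le> L" and st: "(s, t) \<in> rect S T"
    and M: "\<And>r. r \<in> rect S T \<Longrightarrow> \<bar>x r - y r\<bar> \<le> M"
  shows "\<bar>avg x s t - avg y s t\<bar> \<le> M"
proof -
  have "avg x s t - avg y s t = integral {0..1} (\<lambda>\<theta>. x (node s t \<theta>, t) - y (node s t \<theta>, t))"
    unfolding avg_def by (simp add: integral_diff avg_integrable[OF _ L st] x y)
  also have "norm \<dots> \<le> M * measure lborel (cbox 0 (1::real))"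
  proof (rule has_integral_bound)
    show "0 \<le> M" using M[OF st] by linarith
    show "((\<lambda>\<theta>. x (node s t \<theta>, t) - y (node s t \<theta>, t)) has_integral
        integral {0..1} (\<lambda>\<theta>. x (node s t \<theta>, t) - y (node s t \<theta>, t))) (cbox 0 1)"
      using integrable_diff[OF avg_integrable[OF x L st] avg_integrable[OF y L st]]
      by (simp add: integrable_integral)
    show "norm (x (node s t \<theta>, t) - y (node s t \<theta>, t)) \<le> M" if "\<theta> \<in> cbox 0 1" for \<theta>
      using M[of "(node s t \<theta>, t)"] node_in[of s t \<theta>] that st L by (auto simp: rect_def)
  qed
  finally show ?thesis by simp
qed

lemma avg_eq_0:
  assumes "0 \<le> s" "0 \<le> t" "s + t \<le> L" "\<And>\<sigma>. \<sigma> \<in> {0..s} \<Longrightarrow> x (\<sigma>, t) = 0"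
  shows "avg x s t = 0"
proof -
  have "avg x s t = integral {0..1} (\<lambda>\<theta>::real. 0)"
    unfolding avg_def by (intro integral_cong) (use assms node_in in auto)
  then show ?thesis by simp
qed

text \<open>
Substitution \<open>\<theta> = (lam (\<sigma> + t) - lam t) / (lam (s + t) - lam t)\<close>. The integrand \<open>x (node s t \<theta>, t)\<close>
on the other side is continuous, so the Henstock--Kurzweil substitution rule yields existence and
value of the integral although \<open>lam'\<close> may be unbounded.
\<close>

lemma weighted_integral:
  assumes x: "continuous_on (rect S T) x" and L: "S + T \<le> L" and st: "(s, t) \<in> rect S T"
  shows "((\<lambda>\<sigma>. lam' (\<sigma> + t) * x (\<sigma>, t)) has_integral (lam (s + t) - lam t) * avg x s t) {0..s}"
proof (cases "s = 0")
  case True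
  then show ?thesis by (simp add: has_integral_refl)
next
  case False
  with st have s: "0 < s" and t: "0 \<le> t" and st_L: "s + t \<le> L" using L by (auto simp: rect_def)
  define d where "d = lam (s + t) - lam t"
  have d: "0 < d" using lam_less[of t "s + t"] s t st_L by (simp add: d_def)
  define g where "g \<sigma> = (lam (\<sigma> + t) - lam t) / d" for \<sigma>
  have node_g: "node s t (g \<sigma>) = \<sigma>" if "\<sigma> \<in> {0..s}" for \<sigma>
    using that d t st_L inv_lam_lam[of "\<sigma> + t"] by (simp add: node_def g_def flip: d_def)
  have "((\<lambda>\<sigma>. (lam' (\<sigma> + t) / d) *\<^sub>R x (node s t (g \<sigma>), t)) has_integral
      integral {g 0..g s} (\<lambda>\<theta>. x (node s t \<theta>, t))) {0..s}"
  proof (rule has_integral_substitution[where f = "\<lambda>\<theta>. x (node s t \<theta>, t)"])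
    show "0 \<le> s" using s by simp
    show "g 0 \<le> g s" using d by (simp add: g_def d_def)
    show "g ` {0..s} \<subseteq> {0..1}"
    proof clarify
      fix \<sigma> assume \<sigma>: "\<sigma> \<in> {0..s}"
      have "lam t \<le> lam (\<sigma> + t)" "lam (\<sigma> + t) \<le> lam (s + t)"
        using \<sigma> t st_L by (auto intro!: lam_le)
      then show "g \<sigma> \<in> {0..1}" using d by (simp add: g_def) (simp add: d_def)
    qed
    have "continuous_on {0..1} (\<lambda>\<theta>. (\<lambda>(p, \<theta>). x (node (fst p) (snd p) \<theta>, snd p)) ((s, t), \<theta>))"
      using st by (intro continuous_on_compose2[OF continuous_avg_integrand[OF x L]]
          continuous_intros) auto
    then show "continuous_on {0..1} (\<lambda>\<theta>. x (node s t \<theta>, t))" by simp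
    fix \<sigma> assume \<sigma>: "\<sigma> \<in> {0..s}"
    have "(lam has_real_derivative lam' (\<sigma> + t)) (at (\<sigma> + t) within (\<lambda>\<sigma>. \<sigma> + t) ` {0..s})"
      using deriv[of "\<sigma> + t"] by (rule DERIV_subset) (use \<sigma> t st_L in auto)
    then have "((\<lambda>\<sigma>. lam (\<sigma> + t)) has_real_derivative lam' (\<sigma> + t) * 1) (at \<sigma> within {0..s})"
      by (rule DERIV_image_chain[unfolded o_def]) (auto intro!: derivative_eq_intros)
    then show "(g has_real_derivative lam' (\<sigma> + t) / d) (at \<sigma> within {0..s})"
      unfolding g_def using d by (auto intro!: derivative_eq_intros)
  qed
  then have "((\<lambda>\<sigma>. lam' (\<sigma> + t) / d * x (\<sigma>, t)) has_integral avg x s t) {0..s}"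
  proof (rule has_integral_eq_rhs[OF has_integral_eq[rotated]])
    show "avg x s t = integral {g 0..g s} (\<lambda>\<theta>. x (node s t \<theta>, t))"
      using d by (simp add: avg_def g_def flip: d_def)
  qed (simp add: node_g)
  from has_integral_mult_right[OF this, of d] d show ?thesis
    by (simp add: field_simps d_def[symmetric])
qed

section \<open>The Volterra operator\<close>

text \<open>
Both integral terms of the equation after the substitution; the second is the first one for the
reflected function. At the origin the quotient is \<open>0 / 0 = 0\<close>, which is the value prescribed there.
\<close>

definition volterra_op :: "(real \<times> real \<Rightarrow> real) \<Rightarrow> real \<times> real \<Rightarrow> real" where
  "volterra_op x = (\<lambda>(s, t). ((lam (s + t) - lam t) * avg x s t
      + (lam (s + t) - lam s) * avg (x \<circ> prod.swap) t s) / (2 * lam (s + t)))"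

lemma rect_swap: "(t, s) \<in> rect T S \<longleftrightarrow> (s, t) \<in> rect S T"
  by (auto simp: rect_def)

lemma continuous_swap:
  assumes "continuous_on (rect S T) x"
  shows "continuous_on (rect T S) (x \<circ> prod.swap)"
  unfolding o_def using assms
  by (rule continuous_on_compose2) (auto simp: rect_def intro!: continuous_on_swap)

lemma volterra_at_iff:
  assumes x: "continuous_on (rect S T) x" and L: "S + T \<le> L" and st: "(s, t) \<in> rect S T"
  shows "volterra_at lam lam' f x s t \<longleftrightarrow> x (s, t) = f (s, t) + volterra_op x (s, t)"
proof -
  let ?c = "2 * lam (s + t)"
  have "((\<lambda>\<sigma>. lam' (\<sigma> + t) * x (\<sigma>, t) / ?c) has_integral
      (lam (s + t) - lam t) * avg x s t / ?c) {0..s}"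
    by (intro has_integral_divide weighted_integral[OF x L st])
  then have 1: "((\<lambda>\<sigma>. K1 lam lam' s t \<sigma> * x (\<sigma>, t)) has_integral
      (lam (s + t) - lam t) * avg x s t / ?c) {0..s}"
    by (simp add: K1_def)
  have "((\<lambda>\<tau>. lam' (\<tau> + s) * (x \<circ> prod.swap) (\<tau>, s) / ?c) has_integral
      (lam (t + s) - lam s) * avg (x \<circ> prod.swap) t s / ?c) {0..t}"
    using L st by (intro has_integral_divide weighted_integral[OF continuous_swap[OF x]])
      (auto simp: rect_swap)
  then have 2: "((\<lambda>\<tau>. K2 lam lam' s t \<tau> * x (s, \<tau>)) has_integral
      (lam (s + t) - lam s) * avg (x \<circ> prod.swap) t s / ?c) {0..t}"
    by (simp add: K2_def add.commute)
  have "volterra_op x (s, t) = (lam (s + t) - lam t) * avg x s t / ?c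
      + (lam (s + t) - lam s) * avg (x \<circ> prod.swap) t s / ?c"
    by (simp add: volterra_op_def add_divide_distrib)
  then show ?thesis
    using 1 2 by (auto simp: volterra_at_def lam_0 integral_unique has_integral_integrable)
qed

text \<open>
Membership in \<open>C0 S T\<close> without the condition of being extensional, which \<open>volterra_op\<close> does not
preserve.
\<close>

definition vanishing :: "real \<Rightarrow> real \<Rightarrow> (real \<times> real \<Rightarrow> real) set" where
  "vanishing S T = {x. continuous_on (rect S T) x \<and>
    (\<forall>p\<in>rect S T \<inter> {p. fst p = 0 \<or> snd p = 0}. x p = 0)}"

lemma avg_eq_0_on_axes:
  assumes x: "x \<in> vanishing S T" and L: "S + T \<le> L"
    and st: "(s, t) \<in> rect S T" and axis: "s = 0 \<or> t = 0"
  shows "avg x s t = 0" "avg (x \<circ> prod.swap) t s = 0"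
proof -
  have nonneg: "0 \<le> s" "0 \<le> t" "s + t \<le> L" using st L by (auto simp: rect_def)
  show "avg x s t = 0"
    by (rule avg_eq_0) (use nonneg st x axis in \<open>auto simp: vanishing_def rect_def\<close>)
  show "avg (x \<circ> prod.swap) t s = 0"
    by (rule avg_eq_0) (use nonneg st x axis in \<open>auto simp: vanishing_def rect_def\<close>)
qed

text \<open>
The crude bound by \<open>1\<close> is enough for continuity at the origin, and with \<open>0 / 0 = 0\<close> it holds there
too.
\<close>

lemma lam_increment_fraction:
  assumes "0 \<le> s" "0 \<le> t" "s + t \<le> L"
  shows "\<bar>(lam (s + t) - lam t) / (2 * lam (s + t))\<bar> \<le> 1"
    "\<bar>(lam (s + t) - lam s) / (2 * lam (s + t))\<bar> \<le> 1"
proof -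
  have "\<bar>(lam (s + t) - lam u) / (2 * lam (s + t))\<bar> \<le> 1" if "0 \<le> u" "u \<le> s + t" for u
  proof -
    have "0 \<le> lam u" "lam u \<le> lam (s + t)"
      using lam_le[of 0 u] lam_le[of u "s + t"] lam_0 that assms by auto
    then show ?thesis by (simp add: abs_le_iff divide_le_eq)
  qed
  then show "\<bar>(lam (s + t) - lam t) / (2 * lam (s + t))\<bar> \<le> 1"
    "\<bar>(lam (s + t) - lam s) / (2 * lam (s + t))\<bar> \<le> 1" using assms by auto
qed

text \<open>
Away from the origin everything in the definition is continuous and the denominator is nonzero. At
the origin the coefficients of the two averages are bounded and the averages tend to \<open>0\<close>; this is
where \<open>x (0, 0) = 0\<close> is essential, since the limits of the coefficients depend on the direction of
approach.
\<close>

lemma volterra_op_vanishing: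
  assumes x: "x \<in> vanishing S T" and L: "S + T \<le> L"
  shows "volterra_op x \<in> vanishing S T"
proof -
  have cont: "continuous_on (rect S T) x" using x by (simp add: vanishing_def)
  define A where "A = (\<lambda>p. avg x (fst p) (snd p))"
  define B where "B = (\<lambda>p. avg (x \<circ> prod.swap) (snd p) (fst p))"
  have A: "continuous_on (rect S T) A"
    using continuous_avg[OF cont L] by (simp add: A_def case_prod_unfold)
  have B: "continuous_on (rect S T) B"
  proof -
    have "continuous_on (rect T S) (\<lambda>(s, t). avg (x \<circ> prod.swap) s t)"
      using continuous_avg[OF continuous_swap[OF cont]] L by (simp add: add.commute)
    from continuous_swap[OF this] show ?thesis by (simp add: B_def o_def case_prod_unfold)
  qed
  have V_eq: "volterra_op x p = ((lam (fst p + snd p) - lam (snd p)) * A p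
      + (lam (fst p + snd p) - lam (fst p)) * B p) / (2 * lam (fst p + snd p))" for p
    by (simp add: volterra_op_def A_def B_def case_prod_unfold)
  have "continuous (at p within rect S T) (volterra_op x)" if p: "p \<in> rect S T" for p
  proof (cases "p = (0, 0)")
    case False
    let ?U = "rect S T"
    have 1: "continuous_on ?U (\<lambda>p. lam (fst p + snd p))" "continuous_on ?U (\<lambda>p. lam (fst p))"
      "continuous_on ?U (\<lambda>p. lam (snd p))"
      using L by (intro continuous_on_compose2[OF continuous_lam] continuous_intros;
          force simp: rect_def)+
    have "lam (fst p + snd p) \<noteq> 0"
      using lam_pos[of "fst p + snd p"] False p L by (cases p) (force simp: rect_def)
    moreover have "continuous (at p within ?U) (\<lambda>p. lam (fst p + snd p))"
      "continuous (at p within ?U) (\<lambda>p. lam (fst p))" "continuous (at p within ?U) (\<lambda>p. lam (snd p))"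
      "continuous (at p within ?U) A" "continuous (at p within ?U) B"
      using 1 A B p by (auto simp: continuous_on_eq_continuous_within)
    ultimately show ?thesis
      unfolding V_eq[abs_def] by (intro continuous_intros) auto
  next
    case True
    have AB0: "A (0, 0) = 0" "B (0, 0) = 0"
      using avg_eq_0_on_axes[OF x L, of 0 0] p True by (auto simp: A_def B_def)
    have "((\<lambda>r. \<bar>A r\<bar> + \<bar>B r\<bar>) \<longlongrightarrow> \<bar>A (0, 0)\<bar> + \<bar>B (0, 0)\<bar>) (at p within rect S T)"
      using A B p True by (intro tendsto_intros) (auto simp: continuous_on_def)
    then have "((\<lambda>r. \<bar>A r\<bar> + \<bar>B r\<bar>) \<longlongrightarrow> 0) (at p within rect S T)" by (simp add: AB0)
    moreover have "eventually (\<lambda>r. norm (volterra_op x r) \<le> \<bar>A r\<bar> + \<bar>B r\<bar>) (at p within rect S T)"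
      unfolding eventually_at_filter
    proof (rule always_eventually, intro allI impI)
      fix r assume r: "r \<in> rect S T"
      define ca where "ca = (lam (fst r + snd r) - lam (snd r)) / (2 * lam (fst r + snd r))"
      define cb where "cb = (lam (fst r + snd r) - lam (fst r)) / (2 * lam (fst r + snd r))"
      have c: "\<bar>ca\<bar> \<le> 1" "\<bar>cb\<bar> \<le> 1"
        using lam_increment_fraction[of "fst r" "snd r"] r L unfolding ca_def cb_def
        by (auto simp: rect_def)
      have "volterra_op x r = ca * A r + cb * B r"
        by (simp add: V_eq ca_def cb_def add_divide_distrib)
      also have "\<bar>\<dots>\<bar> \<le> \<bar>ca\<bar> * \<bar>A r\<bar> + \<bar>cb\<bar> * \<bar>B r\<bar>"
        by (metis abs_mult abs_triangle_ineq)
      also have "\<dots> \<le> 1 * \<bar>A r\<bar> + 1 * \<bar>B r\<bar>"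
        using c by (intro add_mono mult_right_mono) auto
      finally show "norm (volterra_op x r) \<le> \<bar>A r\<bar> + \<bar>B r\<bar>" by simp
    qed
    ultimately have "(volterra_op x \<longlongrightarrow> 0) (at p within rect S T)"
      by (rule Lim_null_comparison[rotated])
    moreover have "volterra_op x (0, 0) = 0" unfolding V_eq by (simp add: lam_0)
    ultimately show ?thesis unfolding True continuous_within by simp
  qed
  then have "continuous_on (rect S T) (volterra_op x)"
    by (simp add: continuous_on_eq_continuous_within)
  then show ?thesis
    using avg_eq_0_on_axes[OF x L] by (auto simp: vanishing_def volterra_op_def)
qed

text \<open>
\<open>lam u / u\<close> is a difference quotient at \<open>0\<close>, so it extends continuously by \<open>lam' 0 > 0\<close> to the
compact interval and attains a positive minimum and a maximum there.
\<close>

lemma lam_linear_bounds: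
  obtains c C where "0 < c" "c \<le> C" "\<And>u. u \<in> {0..L} \<Longrightarrow> c * u \<le> lam u \<and> lam u \<le> C * u"
proof -
  define g where "g u = (if u = 0 then lam' 0 else lam u / u)" for u
  have "continuous (at u within {0..L}) g" if u: "u \<in> {0..L}" for u
  proof (cases "u = 0")
    case True
    have "((\<lambda>v. (lam v - lam 0) / (v - 0)) \<longlongrightarrow> lam' 0) (at 0 within {0..L})"
      using deriv[of 0] L_pos by (simp add: has_field_derivative_iff)
    then have "(g \<longlongrightarrow> lam' 0) (at 0 within {0..L})"
      by (rule Lim_transform_eventually) (auto simp: eventually_at_filter g_def lam_0)
    then show ?thesis using True by (simp add: continuous_within g_def)
  next
    case False
    have "((\<lambda>v. lam v / v) \<longlongrightarrow> lam u / u) (at u within {0..L})"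
      using False u continuous_lam by (intro tendsto_intros) (auto simp: continuous_on_def)
    moreover have "eventually (\<lambda>v. v \<noteq> 0) (at u within {0..L})"
      using False by (rule tendsto_imp_eventually_ne[OF tendsto_ident_at])
    ultimately have "(g \<longlongrightarrow> lam u / u) (at u within {0..L})"
      by (elim Lim_transform_eventually eventually_mono) (simp add: g_def)
    then show ?thesis using False by (simp add: continuous_within g_def)
  qed
  then have g: "continuous_on {0..L} g" by (simp add: continuous_on_eq_continuous_within)
  have ne: "{0..L} \<noteq> {}" using L_pos by simp
  obtain a where a: "a \<in> {0..L}" "\<And>u. u \<in> {0..L} \<Longrightarrow> g a \<le> g u"
    using continuous_attains_inf[OF compact_Icc ne g] by blast
  obtain b where b: "b \<in> {0..L}" "\<And>u. u \<in> {0..L} \<Longrightarrow> g u \<le> g b"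
    using continuous_attains_sup[OF compact_Icc ne g] by blast
  have "0 < g a" using a lam'_pos[of 0] lam_pos[of a] L_pos by (auto simp: g_def)
  moreover have "g a * u \<le> lam u \<and> lam u \<le> g b * u" if "u \<in> {0..L}" for u
  proof -
    have "lam u = g u * u" using lam_0 by (simp add: g_def)
    then show ?thesis using a(2)[OF that] b(2)[OF that] that by (simp add: mult_right_mono)
  qed
  ultimately show ?thesis using that[of "g a" "g b"] a b by blast
qed

text \<open>
The operator norm is at most the supremum of \<open>1 - (lam s + lam t) / (2 * lam (s + t))\<close>, and the
linear bounds give \<open>lam s + lam t \<ge> c * (s + t) \<ge> (c / C) * lam (s + t)\<close>.
\<close>

lemma volterra_op_contraction:
  obtains q where "0 \<le> q" "q < 1"
    "\<And>S T x y M p. \<lbrakk>S + T \<le> L; continuous_on (rect S T) x; continuous_on (rect S T) y;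
      \<And>r. r \<in> rect S T \<Longrightarrow> \<bar>x r - y r\<bar> \<le> M; p \<in> rect S T\<rbrakk> \<Longrightarrow> \<bar>volterra_op x p - volterra_op y p\<bar> \<le> q * M"
proof -
  obtain c C where c: "0 < c" "c \<le> C"
    and lin: "\<And>u. u \<in> {0..L} \<Longrightarrow> c * u \<le> lam u \<and> lam u \<le> C * u"
    using lam_linear_bounds by metis
  define q where "q = 1 - c / (2 * C)"
  have q: "0 \<le> q" "q < 1" using c by (auto simp: q_def field_simps)
  have "\<bar>volterra_op x p - volterra_op y p\<bar> \<le> q * M"
    if L: "S + T \<le> L" and x: "continuous_on (rect S T) x" and y: "continuous_on (rect S T) y"
      and M: "\<And>r. r \<in> rect S T \<Longrightarrow> \<bar>x r - y r\<bar> \<le> M" and p: "p \<in> rect S T"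
    for S T x y M p
  proof (cases p)
    case (Pair s t)
    have st: "0 \<le> s" "0 \<le> t" "s + t \<le> L" using p L Pair by (auto simp: rect_def)
    have M0: "0 \<le> M" using M[OF p] by linarith
    show ?thesis
    proof (cases "s + t = 0")
      case True
      then show ?thesis using q M0 Pair by (simp add: volterra_op_def lam_0)
    next
      case False
      then have l: "0 < lam (s + t)" using lam_pos[of "s + t"] st by simp
      define a where "a = avg x s t - avg y s t"
      define b where "b = avg (x \<circ> prod.swap) t s - avg (y \<circ> prod.swap) t s"
      have a: "\<bar>a\<bar> \<le> M"
        unfolding a_def using p Pair by (intro avg_diff_le[OF x y L]) (auto intro: M)
      have b: "\<bar>b\<bar> \<le> M"
        unfolding b_def using p Pair L
        by (intro avg_diff_le[OF continuous_swap[OF x] continuous_swap[OF y]])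
          (auto simp: rect_swap intro: M)
      have inc: "0 \<le> lam (s + t) - lam t" "0 \<le> lam (s + t) - lam s"
        using lam_le[of t "s + t"] lam_le[of s "s + t"] st by auto
      have "c * lam (s + t) \<le> c * (C * (s + t))"
        using c lin[of "s + t"] st by (intro mult_left_mono) auto
      also have "\<dots> = C * (c * s + c * t)" by (simp add: algebra_simps)
      also have "\<dots> \<le> C * (lam s + lam t)"
        using c lin[of s] lin[of t] st by (intro mult_left_mono add_mono) auto
      finally have key: "c / C * lam (s + t) \<le> lam s + lam t"
        using c by (simp add: field_simps)
      have "volterra_op x p - volterra_op y p = ((lam (s + t) - lam t) * a + (lam (s + t) - lam s) * b)
          / (2 * lam (s + t))"
        using Pair by (simp add: volterra_op_def a_def b_def right_diff_distrib add_divide_distrib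
            diff_divide_distrib)
      also have "\<bar>\<dots>\<bar> = \<bar>(lam (s + t) - lam t) * a + (lam (s + t) - lam s) * b\<bar> / (2 * lam (s + t))"
        using l by (simp add: abs_divide)
      also have "\<dots> \<le> ((lam (s + t) - lam t) * M + (lam (s + t) - lam s) * M) / (2 * lam (s + t))"
      proof (intro divide_right_mono order.trans[OF abs_triangle_ineq] add_mono)
        show "\<bar>(lam (s + t) - lam t) * a\<bar> \<le> (lam (s + t) - lam t) * M"
          using a inc by (simp add: abs_mult mult_left_mono)
        show "\<bar>(lam (s + t) - lam s) * b\<bar> \<le> (lam (s + t) - lam s) * M"
          using b inc by (simp add: abs_mult mult_left_mono)
      qed (use l in simp)
      also have "\<dots> = (1 - (lam s + lam t) / (2 * lam (s + t))) * M"
        using l by (simp add: field_simps)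
      also have "\<dots> \<le> q * M"
      proof (rule mult_right_mono[OF _ M0])
        have "c / C \<le> (lam s + lam t) / lam (s + t)"
          using key l by (simp add: pos_le_divide_eq)
        then show "1 - (lam s + lam t) / (2 * lam (s + t)) \<le> q" by (simp add: q_def)
      qed
      finally show ?thesis .
    qed
  qed
  then show ?thesis using that q by blast
qed

end

theorem theorem6p5:
  fixes S T :: real and lam lam' :: "real \<Rightarrow> real" and f :: "real \<times> real \<Rightarrow> real"
  assumes "S > 0" and "T > 0"
    and "lam 0 = 0"
    and "\<And>u. u \<in> {0..S + T} \<Longrightarrow> (lam has_real_derivative lam' u) (at u within {0..S + T})"
    and "continuous_on {0<..<S + T} lam'"
    and "\<And>u. u \<in> {0..S + T} \<Longrightarrow> lam' u > 0"
    and "f \<in> C0 S T"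
  shows "\<exists>!x. x \<in> C0 S T \<and> (\<forall>(s, t)\<in>rect S T. volterra_at lam lam' f x s t)"
proof -
  interpret monotone_weight "S + T" lam lam'
    by unfold_locales (use assms in auto)
  have box: "rect S T = cbox (0, 0) (S, T)"
    by (auto simp: rect_def cbox_Pair_eq)
  have C0: "x \<in> C0 S T \<longleftrightarrow> x \<in> extensional (rect S T) \<and> x \<in> vanishing S T" for x
    using assms(1,2) by (auto simp: C0_def vanishing_def rect_def)
  then have f: "f \<in> vanishing S T" using assms(7) by blast
  obtain q where q: "0 \<le> q" "q < 1"
    and contr: "\<And>x y M p. \<lbrakk>continuous_on (rect S T) x; continuous_on (rect S T) y;
      \<And>r. r \<in> rect S T \<Longrightarrow> \<bar>x r - y r\<bar> \<le> M; p \<in> rect S T\<rbrakk> \<Longrightarrow> \<bar>volterra_op x p - volterra_op y p\<bar> \<le> q * M"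
    using volterra_op_contraction by (metis order_refl)
  have "\<exists>!x. x \<in> extensional (rect S T) \<and> x \<in> vanishing S T \<and> (\<forall>p\<in>rect S T. x p = f p + volterra_op x p)"
    unfolding box
  proof (rule contraction_on_box_unique_fixed_point[OF _ _ q vanishing_def[of S T, unfolded box]])
    show "(\<lambda>p. f p + volterra_op x p) \<in> vanishing S T" if "x \<in> vanishing S T" for x
      using f volterra_op_vanishing[OF that] by (auto simp: vanishing_def intro!: continuous_intros)
  next
    fix x y M p
    assume "x \<in> vanishing S T" "y \<in> vanishing S T" "p \<in> cbox (0, 0) (S, T)"
      and "\<And>r. r \<in> cbox (0, 0) (S, T) \<Longrightarrow> \<bar>x r - y r\<bar> \<le> M"
    then show "\<bar>f p + volterra_op x p - (f p + volterra_op y p)\<bar> \<le> q * M"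
      using contr[of x y M p] by (simp add: vanishing_def box)
  qed (use assms(1,2) in \<open>auto simp: cbox_Pair_eq\<close>)
  moreover have "(x \<in> C0 S T \<and> (\<forall>(s, t)\<in>rect S T. volterra_at lam lam' f x s t)) \<longleftrightarrow>
      x \<in> extensional (rect S T) \<and> x \<in> vanishing S T \<and> (\<forall>p\<in>rect S T. x p = f p + volterra_op x p)" for x
    unfolding C0 using volterra_at_iff[of S T x] by (auto simp: vanishing_def)
  ultimately show ?thesis by simp
qed

end
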